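(* Let $(p_i)_{i\ge1}$ be a sequence in $(0,1)$ and $(m_i)_{i\ge1}$ a sequence of positive integers. For each $n$, consider a committee of the $n$ experts with competences $p_1,\dots,p_n$ and sample sizes $m_1,\dots,m_n$, as described in the context, and let $\hat f^{\mathrm{LC}}$ be the low-confidence empirical decision rule $$\hat f^{\mathrm{LC}}(\mathbf{x},\mathbf{k})=\operatorname{sign}\left(\sum_{i=1}^n\left(\frac{k_i}{m_i}-\frac12\right)x_i\right).$$ If $$\frac{1}{\sqrt n}\sum_{i=1}^n\left(p_i-\tfrac12\right)^2\longrightarrow\infty\quad\text{as } n\to\infty,$$ then $\mathbb{P}\left(\hat f^{\mathrm{LC}}(\mathbf{X},\mathbf{K})\neq Y\right)\to0$ as $n\to\infty$.
   Context: Setting: $Y\in\{\pm1\}$ is uniform; $\mathbf{X}=(X_1,\dots,X_n)\in\{\pm1\}^n$ are the expert votes; the correctness indicators $\xi_i=\mathbf{1}\{X_i=Y\}$ are mutually independent and jointly independent of $Y$, with $\mathbb{P}(X_i=Y)=p_i$. In addition, expert $i$ has previously been queried independently $m_i$ times ($m_i$ fixed) and was correct $k_i$ times; thus the committee profile $\mathbf{K}=(k_1,\dots,k_n)$ has independent components $k_i\sim\mathrm{Binomial}(m_i,p_i)$ and is independent of $(\mathbf{X},Y)$. The probability of error is over $\mathbf{X},Y,\mathbf{K}$. Ties are counted as errors: with $\hat w_i=k_i/m_i-\frac12$ and $\eta_i=2\xi_i-1$, the error event is $\sum_{i=1}^n\hat w_i\eta_i\le0$. *)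

theory Defs
  imports "HOL-Probability.Probability"
begin

text \<open>
  Independence of two random variables with values in different types; \<open>indep_var\<close> requires
  both to have the same value type.
\<close>

definition (in prob_space) indep_rvs ::
  "'b measure \<Rightarrow> ('a \<Rightarrow> 'b) \<Rightarrow> 'c measure \<Rightarrow> ('a \<Rightarrow> 'c) \<Rightarrow> bool" where
  "indep_rvs S U T V \<longleftrightarrow> random_variable S U \<and> random_variable T V \<and>
     indep_set {U -` A \<inter> space M | A. A \<in> sets S} {V -` B \<inter> space M | B. B \<in> sets T}"

lemma (in prob_space) indep_rvs_iff_indep_var: "indep_rvs S U T V \<longleftrightarrow> indep_var S U T V"
proof -
  have *: "sigma_sets (space M) {f -` A \<inter> space M | A. A \<in> sets N}
      = {f -` A \<inter> space M | A. A \<in> sets N}" if "random_variable N f" for f and N :: "'b measure"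
  proof -
    have "f \<in> space M \<rightarrow> space N"
      using measurable_space[OF that] by blast
    from sets_vimage_algebra2[OF this] show ?thesis
      unfolding sets_vimage_algebra by simp
  qed
  show ?thesis
  proof (cases "random_variable S U \<and> random_variable T V")
    case True
    then show ?thesis
      unfolding indep_rvs_def indep_var_eq by (simp only: * simp_thms)
  next
    case False
    then show ?thesis
      unfolding indep_rvs_def indep_var_eq by blast
  qed
qed

text \<open>
  A committee of experts \<open>1, \<dots>, n\<close> voting on a label \<open>Y\<close>. Expert \<open>i\<close> votes \<open>X i\<close>, has competence
  \<open>p i\<close>, and was correct on \<open>K i\<close> out of \<open>m i\<close> earlier queries.
\<close>

locale committee = prob_space M for M :: "'a measure" +
  fixes n :: nat
    and p :: "nat \<Rightarrow> real"
    and m :: "nat \<Rightarrow> nat"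
    and Y :: "'a \<Rightarrow> real"
    and X :: "nat \<Rightarrow> 'a \<Rightarrow> real"
    and K :: "nat \<Rightarrow> 'a \<Rightarrow> nat"
  assumes Y_measurable: "random_variable borel Y"
    and X_measurable: "\<And>i. i \<in> {1..n} \<Longrightarrow> random_variable borel (X i)"
    and Y_values: "\<And>\<omega>. \<omega> \<in> space M \<Longrightarrow> Y \<omega> \<in> {-1, 1}"
    and X_values: "\<And>i \<omega>. i \<in> {1..n} \<Longrightarrow> \<omega> \<in> space M \<Longrightarrow> X i \<omega> \<in> {-1, 1}"
    and Y_uniform: "\<And>y. y \<in> {-1, 1} \<Longrightarrow> prob {\<omega> \<in> space M. Y \<omega> = y} = 1 / 2"
    and competence: "\<And>i. i \<in> {1..n} \<Longrightarrow> prob {\<omega> \<in> space M. X i \<omega> = Y \<omega>} = p i"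
    and correct_indep:
      "indep_vars (\<lambda>_. borel) (\<lambda>i \<omega>. of_bool (X i \<omega> = Y \<omega>) :: real) {1..n}"
    and correct_indep_Y:
      "indep_rvs (PiM {1..n} (\<lambda>_. borel)) (\<lambda>\<omega>. \<lambda>i\<in>{1..n}. of_bool (X i \<omega> = Y \<omega>) :: real) borel Y"
    and K_binomial:
      "\<And>i. i \<in> {1..n} \<Longrightarrow> distr M (count_space UNIV) (K i) = measure_pmf (binomial_pmf (m i) (p i))"
    and K_indep: "indep_vars (\<lambda>_. count_space UNIV) K {1..n}"
    and K_indep_votes:
      "indep_rvs (PiM {1..n} (\<lambda>_. count_space UNIV)) (\<lambda>\<omega>. \<lambda>i\<in>{1..n}. K i \<omega>)
         (PiM {1..n} (\<lambda>_. borel) \<Otimes>\<^sub>M borel) (\<lambda>\<omega>. (\<lambda>i\<in>{1..n}. X i \<omega>, Y \<omega>))"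

definition lc_weight :: "(nat \<Rightarrow> nat) \<Rightarrow> (nat \<Rightarrow> nat) \<Rightarrow> nat \<Rightarrow> real" where
  "lc_weight m k i = real (k i) / real (m i) - 1 / 2"

text \<open>
  Since \<open>sgn 0 = 0\<close> is not an admissible label, a tie always disagrees with \<open>Y\<close> and is
  therefore an error; see \<open>committee.lc_rule_error_iff\<close> below.
\<close>

definition lc_rule :: "nat \<Rightarrow> (nat \<Rightarrow> nat) \<Rightarrow> (nat \<Rightarrow> real) \<Rightarrow> (nat \<Rightarrow> nat) \<Rightarrow> real" where
  "lc_rule n m x k = sgn (\<Sum>i=1..n. lc_weight m k i * x i)"

lemma (in committee) lc_rule_error_iff:
  assumes "\<omega> \<in> space M"
  shows "lc_rule n m (\<lambda>i. X i \<omega>) (\<lambda>i. K i \<omega>) \<noteq> Y \<omega> \<longleftrightarrow>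
    (\<Sum>i=1..n. lc_weight m (\<lambda>i. K i \<omega>) i * (2 * of_bool (X i \<omega> = Y \<omega>) - 1)) \<le> 0"
proof -
  let ?w = "lc_weight m (\<lambda>i. K i \<omega>)"
  have Y: "Y \<omega> = 1 \<or> Y \<omega> = -1"
    using Y_values[OF assms] by auto
  have "2 * of_bool (X i \<omega> = Y \<omega>) - 1 = Y \<omega> * X i \<omega>" if "i \<in> {1..n}" for i
    using X_values[OF that assms] Y_values[OF assms] by fastforce
  then have "(\<Sum>i=1..n. ?w i * (2 * of_bool (X i \<omega> = Y \<omega>) - 1))
      = (\<Sum>i=1..n. ?w i * (Y \<omega> * X i \<omega>))"
    by (intro sum.cong refl arg_cong2[where f = "(*)"])
  also have "\<dots> = Y \<omega> * (\<Sum>i=1..n. ?w i * X i \<omega>)"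
    by (simp only: sum_distrib_left mult.left_commute)
  finally have eq: "(\<Sum>i=1..n. ?w i * (2 * of_bool (X i \<omega> = Y \<omega>) - 1)) = \<dots>" .
  have "sgn s \<noteq> y \<longleftrightarrow> y * s \<le> 0" if "y = 1 \<or> y = -1" for s y :: real
    using that by (auto simp: sgn_if)
  from this[OF Y] show ?thesis
    unfolding eq lc_rule_def .
qed

end

theory Submission
  imports Defs
begin

text \<open>
  The rule errs exactly if \<open>S = \<Sum>i. w\<^sub>i * \<eta>\<^sub>i \<le> 0\<close>, where \<open>w\<^sub>i\<close> is the empirical weight and
  \<open>\<eta>\<^sub>i = \<plusminus>1\<close> says whether expert \<open>i\<close> is right. The summands are pairwise uncorrelated, have mean
  \<open>(p\<^sub>i - 1/2) * (2 * p\<^sub>i - 1) = 2 * (p\<^sub>i - 1/2)\<^sup>2\<close> and are bounded by \<open>1/2\<close>. Chebyshev's inequality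
  therefore bounds the error probability by \<open>(n / 4) / (2 * \<Sum>i. (p\<^sub>i - 1/2)\<^sup>2)\<^sup>2\<close>, the
  inverse square of the diverging quantity up to a constant.
\<close>

text \<open>The binomial weights are the Bernstein basis polynomials evaluated at \<open>p\<close>,
  so the mean is the classical first-moment identity for these polynomials.\<close>

lemma expectation_binomial_pmf_of_nat:
  assumes "p \<in> {0..1}"
  shows "measure_pmf.expectation (binomial_pmf n p) real = real n * p"
  using assms sum_k_Bernstein[of n p]
  by (simp add: expectation_binomial_pmf' Bernstein_def mult_ac)

section \<open>Variances and independence on a general probability space\<close>

context prob_space
begin

text \<open>Expanding the square gives a double sum of covariances whose off-diagonal terms vanish.
  Asking only for pairwise uncorrelated summands avoids having to show that the products of weight
  and correctness sign are mutually independent.\<close>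

lemma variance_sum_uncorrelated:
  fixes Z :: "'i \<Rightarrow> 'a \<Rightarrow> real"
  assumes fin: "finite I"
    and int: "\<And>i. i \<in> I \<Longrightarrow> integrable M (Z i)"
    and int2: "\<And>i j. i \<in> I \<Longrightarrow> j \<in> I \<Longrightarrow> integrable M (\<lambda>x. Z i x * Z j x)"
    and uncorrelated: "\<And>i j. i \<in> I \<Longrightarrow> j \<in> I \<Longrightarrow> i \<noteq> j \<Longrightarrow>
      expectation (\<lambda>x. Z i x * Z j x) = expectation (Z i) * expectation (Z j)"
  shows "variance (\<lambda>x. \<Sum>i\<in>I. Z i x) = (\<Sum>i\<in>I. variance (Z i))"
proof -
  have int2sq: "integrable M (\<lambda>x. (Z i x)\<^sup>2)" if "i \<in> I" for i
    using int2[OF that that] by (simp add: power2_eq_square)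
  have sq: "(\<Sum>i\<in>I. Z i x)\<^sup>2 = (\<Sum>i\<in>I. \<Sum>j\<in>I. Z i x * Z j x)" for x
    by (simp add: power2_eq_square sum_product)
  have E: "expectation (\<lambda>x. \<Sum>i\<in>I. Z i x) = (\<Sum>i\<in>I. expectation (Z i))"
    using int by (simp add: Bochner_Integration.integral_sum)
  have E2: "expectation (\<lambda>x. (\<Sum>i\<in>I. Z i x)\<^sup>2) = (\<Sum>i\<in>I. \<Sum>j\<in>I. expectation (\<lambda>x. Z i x * Z j x))"
    unfolding sq using int2 by (simp add: Bochner_Integration.integral_sum)
  have "variance (\<lambda>x. \<Sum>i\<in>I. Z i x)
      = (\<Sum>i\<in>I. \<Sum>j\<in>I. expectation (\<lambda>x. Z i x * Z j x) - expectation (Z i) * expectation (Z j))"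
    using int int2
    by (subst variance_eq)
       (simp_all add: E E2 sq sum_subtractf power2_eq_square sum_product)
  also have "\<dots> = (\<Sum>i\<in>I. \<Sum>j\<in>I. if i = j then variance (Z i) else 0)"
    using int int2 int2sq uncorrelated
    by (intro sum.cong refl) (auto simp: variance_eq simp flip: power2_eq_square)
  also have "\<dots> = (\<Sum>i\<in>I. variance (Z i))"
    using fin by (intro sum.cong) auto
  finally show ?thesis .
qed

text \<open>The variance is at most the second moment. The bound is only required almost everywhere
  because the empirical weights are bounded only almost surely.\<close>

lemma variance_le_of_bounded:
  fixes Z :: "'a \<Rightarrow> real"
  assumes [measurable]: "random_variable borel Z" and bound: "AE x in M. \<bar>Z x\<bar> \<le> B"
  shows "variance Z \<le> B\<^sup>2"
proof -
  have bound2: "AE x in M. (Z x)\<^sup>2 \<le> B\<^sup>2"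
    using bound by eventually_elim (simp add: abs_le_square_iff[symmetric])
  have int: "integrable M Z" "integrable M (\<lambda>x. (Z x)\<^sup>2)"
    using bound bound2 by (auto intro!: integrable_const_bound)
  then have "variance Z \<le> expectation (\<lambda>x. (Z x)\<^sup>2)"
    by (simp add: variance_eq)
  also have "\<dots> \<le> B\<^sup>2"
    using integral_mono_AE[OF int(2) _ bound2] by (simp add: prob_space)
  finally show ?thesis .
qed

text \<open>Every preimage under \<open>f \<circ> U\<close> is already a preimage under
  \<open>U\<close>, so composing shrinks both set systems, and independence passes to smaller
  systems.\<close>

lemma indep_rvs_compose:
  assumes ind: "indep_rvs S U T V" and f: "f \<in> measurable S S'" and g: "g \<in> measurable T T'"
  shows "indep_rvs S' (f \<circ> U) T' (g \<circ> V)"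
proof -
  have U: "random_variable S U" and V: "random_variable T V"
    using ind by (auto simp: indep_rvs_def)
  have preimage: "{(h \<circ> Z) -` A \<inter> space M | A. A \<in> sets N'} \<subseteq> {Z -` A \<inter> space M | A. A \<in> sets N}"
    if Z: "random_variable N Z" and h: "h \<in> measurable N N'"
    for Z h and N :: "'x measure" and N' :: "'y measure"
  proof safe
    fix A assume "A \<in> sets N'"
    then have "h -` A \<inter> space N \<in> sets N"
      using h by (rule measurable_sets[rotated])
    moreover have "(h \<circ> Z) -` A \<inter> space M = Z -` (h -` A \<inter> space N) \<inter> space M"
      using measurable_space[OF Z] by auto
    ultimately show "\<exists>B. (h \<circ> Z) -` A \<inter> space M = Z -` B \<inter> space M \<and> B \<in> sets N"
      by blast
  qed
  have "indep_set {(f \<circ> U) -` A \<inter> space M | A. A \<in> sets S'} {(g \<circ> V) -` B \<inter> space M | B. B \<in> sets T'}"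
    using ind preimage[OF U f] preimage[OF V g] unfolding indep_rvs_def indep_set_def
    by (elim conjE indep_sets_mono_sets) (auto split: bool.split)
  then show ?thesis
    using U V f g by (simp add: indep_rvs_def measurable_comp)
qed

lemma indep_vars_expectation_mult:
  fixes Z :: "'i \<Rightarrow> 'a \<Rightarrow> real"
  assumes ind: "indep_vars (\<lambda>_. borel) Z I" and ij: "i \<in> I" "j \<in> I" "i \<noteq> j"
    and int: "integrable M (Z i)" "integrable M (Z j)"
  shows "expectation (\<lambda>x. Z i x * Z j x) = expectation (Z i) * expectation (Z j)"
proof -
  have "indep_vars (\<lambda>_. borel) Z {i, j}"
    using indep_vars_subset[OF ind] ij by auto
  from indep_vars_lebesgue_integral[OF _ this] show ?thesis
    using ij int by auto
qed

end

section \<open>Moments and independence of the weights and correctness signs\<close>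

context committee
begin

definition W :: "nat \<Rightarrow> 'a \<Rightarrow> real" where
  "W i \<omega> = lc_weight m (\<lambda>i. K i \<omega>) i"

definition \<eta> :: "nat \<Rightarrow> 'a \<Rightarrow> real" where
  "\<eta> i \<omega> = 2 * of_bool (X i \<omega> = Y \<omega>) - 1"

lemma measurable_K:
  assumes "i \<in> {1..n}"
  shows "random_variable (count_space UNIV) (K i)"
  using K_indep assms by (auto simp: indep_vars_def)

lemma measurable_W:
  assumes "i \<in> {1..n}"
  shows "random_variable borel (W i)"
  using measurable_K[OF assms] unfolding W_def lc_weight_def by measurable

lemma measurable_\<eta>:
  assumes "i \<in> {1..n}"
  shows "random_variable borel (\<eta> i)"
  using X_measurable[OF assms] Y_measurable unfolding \<eta>_def by measurable

lemma abs_\<eta>: "\<bar>\<eta> i \<omega>\<bar> = 1"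
  by (simp add: \<eta>_def of_bool_def)

lemma competence_mem:
  assumes "i \<in> {1..n}"
  shows "p i \<in> {0..1}"
  using competence[OF assms] by (metis atLeastAtMost_iff measure_nonneg prob_le_1)

text \<open>Only the distribution of \<open>K i\<close> is prescribed, so
  \<open>K i \<omega> \<le> m i\<close> may fail on a null set. It holds almost surely since the
  binomial distribution is supported on \<open>{0..m i}\<close>, and then the empirical frequency
  lies in \<open>[0, 1]\<close>.\<close>

lemma AE_abs_W:
  assumes i: "i \<in> {1..n}" and m: "m i > 0"
  shows "AE \<omega> in M. \<bar>W i \<omega>\<bar> \<le> 1 / 2"
proof -
  have "AE k in measure_pmf (binomial_pmf (m i) (p i)). k \<le> m i"
    using competence_mem[OF i] by (auto simp: AE_measure_pmf_iff set_pmf_binomial_eq)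
  then have "AE k in distr M (count_space UNIV) (K i). k \<le> m i"
    unfolding K_binomial[OF i] .
  then have "AE \<omega> in M. K i \<omega> \<le> m i"
    using measurable_K[OF i] by (simp add: AE_distr_iff)
  then show ?thesis
  proof eventually_elim
    case (elim \<omega>)
    then have "0 \<le> real (K i \<omega>) / real (m i)" "real (K i \<omega>) / real (m i) \<le> 1"
      using m by simp_all
    then show ?case
      unfolding W_def lc_weight_def by linarith
  qed
qed

lemma integrable_W:
  assumes "i \<in> {1..n}" "m i > 0"
  shows "integrable M (W i)"
  using AE_abs_W[OF assms] measurable_W assms
  by (intro integrable_const_bound[where B = "1 / 2"]) auto

lemma integrable_\<eta>:
  assumes "i \<in> {1..n}"
  shows "integrable M (\<eta> i)"
  using measurable_\<eta>[OF assms] by (intro integrable_const_bound[where B = 1]) (auto simp: abs_\<eta>)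

text \<open>The empirical frequency is an unbiased estimate of the competence: the binomial mean is
  \<open>m i * p i\<close>, and the nonzero factor \<open>m i\<close> cancels.\<close>

lemma expectation_W:
  assumes i: "i \<in> {1..n}" and m: "m i > 0"
  shows "expectation (W i) = p i - 1 / 2"
proof -
  have p: "p i \<in> {0..1}"
    by (rule competence_mem[OF i])
  have "expectation (W i)
      = integral\<^sup>L (distr M (count_space UNIV) (K i)) (\<lambda>k. real k / real (m i) - 1 / 2)"
    using measurable_K[OF i] by (subst integral_distr) (auto simp: W_def[abs_def] lc_weight_def)
  also have "\<dots> = measure_pmf.expectation (binomial_pmf (m i) (p i)) real / real (m i) - 1 / 2"
    using p by (simp add: K_binomial[OF i])
  also have "\<dots> = p i - 1 / 2"
    using m p by (simp add: expectation_binomial_pmf_of_nat)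
  finally show ?thesis .
qed

lemma expectation_\<eta>:
  assumes i: "i \<in> {1..n}"
  shows "expectation (\<eta> i) = 2 * p i - 1"
proof -
  let ?A = "{\<omega> \<in> space M. X i \<omega> = Y \<omega>}"
  have A: "?A \<in> events"
    using X_measurable[OF i] Y_measurable by measurable
  have "expectation (\<eta> i) = expectation (\<lambda>\<omega>. 2 * indicator ?A \<omega> - 1)"
    by (intro Bochner_Integration.integral_cong) (auto simp: \<eta>_def indicator_def)
  also have "\<dots> = 2 * p i - 1"
    using A competence[OF i]
    by (subst Bochner_Integration.integral_diff)
       (auto simp: prob_space intro!: integrable_real_indicator simp: emeasure_eq_measure)
  finally show ?thesis .
qed

lemma indep_W: "indep_vars (\<lambda>_. borel) W {1..n}"
  unfolding W_def lc_weight_def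
  by (rule indep_vars_compose2[OF K_indep, where Y = "\<lambda>i k. real k / real (m i) - 1 / 2"]) simp

lemma indep_\<eta>: "indep_vars (\<lambda>_. borel) \<eta> {1..n}"
  unfolding \<eta>_def
  by (rule indep_vars_compose2[OF correct_indep, where Y = "\<lambda>_ x. 2 * x - 1"]) simp

text \<open>Weights depend only on the committee profile, and correctness signs only on the votes
  and the label; these two vectors are independent. The case \<open>i = j\<close> is included and
  serves for second moments.\<close>

lemma indep_weights_correctness:
  assumes i: "i \<in> {1..n}" and j: "j \<in> {1..n}"
  shows "indep_var borel (\<lambda>\<omega>. W i \<omega> * W j \<omega>) borel (\<lambda>\<omega>. \<eta> i \<omega> * \<eta> j \<omega>)"
    and "indep_var borel (W i) borel (\<eta> i)"
proof -
  \<comment> \<open>\<open>w\<close> and \<open>e\<close> are \<open>W\<close> and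
    \<open>\<eta>\<close> rewritten as functions of the profile vector and of the pair of vote
    vector and label, the forms in which \<open>K_indep_votes\<close> gives independence.\<close>
  define w where "w i k = real (k i) / real (m i) - 1 / 2" for i and k :: "nat \<Rightarrow> nat"
  define e where "e i z = (2 * of_bool (fst z i = snd z) - 1 :: real)"
    for i and z :: "(nat \<Rightarrow> real) \<times> real"
  have meas: "w i \<in> borel_measurable (PiM {1..n} (\<lambda>_. count_space UNIV))"
    "e i \<in> borel_measurable (PiM {1..n} (\<lambda>_. borel) \<Otimes>\<^sub>M borel)" if "i \<in> {1..n}" for i
  proof -
    have proj: "(\<lambda>k. k i) \<in> measurable (PiM {1..n} (\<lambda>_. count_space UNIV)) (count_space (UNIV :: nat set))"
      and [measurable]: "(\<lambda>k. k i) \<in> borel_measurable (PiM {1..n} (\<lambda>_. borel :: real measure))"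
      using that by (auto intro: measurable_component_singleton)
    show "w i \<in> borel_measurable (PiM {1..n} (\<lambda>_. count_space UNIV))"
      unfolding w_def by (rule measurable_compose[OF proj]) simp
    show "e i \<in> borel_measurable (PiM {1..n} (\<lambda>_. borel) \<Otimes>\<^sub>M borel)"
      unfolding e_def by measurable
  qed
  note [measurable] = meas[OF i] meas[OF j]
  have eq: "W i = w i \<circ> (\<lambda>\<omega>. \<lambda>i\<in>{1..n}. K i \<omega>)" "\<eta> i = e i \<circ> (\<lambda>\<omega>. (\<lambda>i\<in>{1..n}. X i \<omega>, Y \<omega>))"
    if "i \<in> {1..n}" for i
    using that by (auto simp: fun_eq_iff W_def lc_weight_def w_def \<eta>_def e_def)
  \<comment> \<open>After composition both variables are real valued, so \<open>indep_var\<close>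
    and its product rules apply.\<close>
  note indep = indep_rvs_compose[OF K_indep_votes, THEN indep_rvs_iff_indep_var[THEN iffD1]]
  show "indep_var borel (W i) borel (\<eta> i)"
    unfolding eq[OF i] by (rule indep) measurable
  have "indep_var borel ((\<lambda>k. w i k * w j k) \<circ> (\<lambda>\<omega>. \<lambda>i\<in>{1..n}. K i \<omega>))
      borel ((\<lambda>z. e i z * e j z) \<circ> (\<lambda>\<omega>. (\<lambda>i\<in>{1..n}. X i \<omega>, Y \<omega>)))"
    by (rule indep) measurable
  then show "indep_var borel (\<lambda>\<omega>. W i \<omega> * W j \<omega>) borel (\<lambda>\<omega>. \<eta> i \<omega> * \<eta> j \<omega>)"
    by (simp only: eq[OF i] eq[OF j] comp_def)
qed

lemma integrable_W_mult:
  assumes "i \<in> {1..n}" "j \<in> {1..n}" "m i > 0" "m j > 0"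
  shows "integrable M (\<lambda>\<omega>. W i \<omega> * W j \<omega>)"
proof (rule integrable_const_bound[where B = "1 / 2 * (1 / 2)"])
  show "AE \<omega> in M. norm (W i \<omega> * W j \<omega>) \<le> 1 / 2 * (1 / 2)"
    using AE_abs_W[OF assms(1,3)] AE_abs_W[OF assms(2,4)]
    by eventually_elim (simp only: real_norm_def abs_mult mult_mono abs_ge_zero)
qed (use measurable_W assms in auto)

lemma integrable_\<eta>_mult:
  assumes "i \<in> {1..n}" "j \<in> {1..n}"
  shows "integrable M (\<lambda>\<omega>. \<eta> i \<omega> * \<eta> j \<omega>)"
  using measurable_\<eta> assms
  by (intro integrable_const_bound[where B = 1]) (auto simp: abs_\<eta> abs_mult)

section \<open>Moments of the summands and the Chebyshev bound\<close>

lemma expectation_summand: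
  assumes i: "i \<in> {1..n}" and m: "m i > 0"
  shows "expectation (\<lambda>\<omega>. W i \<omega> * \<eta> i \<omega>) = 2 * (p i - 1 / 2)\<^sup>2"
proof -
  have "expectation (\<lambda>\<omega>. W i \<omega> * \<eta> i \<omega>) = (p i - 1 / 2) * (2 * p i - 1)"
    using indep_var_lebesgue_integral[OF indep_weights_correctness(2) integrable_W integrable_\<eta>] i m
    by (simp add: expectation_W expectation_\<eta>)
  then show ?thesis
    by (simp add: power2_eq_square algebra_simps)
qed

text \<open>The product is regrouped as weights times signs. Independence of profile and votes
  separates the two groups, and independence across experts then splits each group. The four means
  recombine into the product of the means of the two summands.\<close>

lemma summands_product:
  assumes i: "i \<in> {1..n}" and j: "j \<in> {1..n}" and m: "m i > 0" "m j > 0"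
  shows "integrable M (\<lambda>\<omega>. (W i \<omega> * \<eta> i \<omega>) * (W j \<omega> * \<eta> j \<omega>))"
    and "i \<noteq> j \<Longrightarrow> expectation (\<lambda>\<omega>. (W i \<omega> * \<eta> i \<omega>) * (W j \<omega> * \<eta> j \<omega>))
      = expectation (\<lambda>\<omega>. W i \<omega> * \<eta> i \<omega>) * expectation (\<lambda>\<omega>. W j \<omega> * \<eta> j \<omega>)"
proof -
  note ints = indep_weights_correctness(1)[OF i j] integrable_W_mult[OF i j m] integrable_\<eta>_mult[OF i j]
  have eq: "(\<lambda>\<omega>. (W i \<omega> * \<eta> i \<omega>) * (W j \<omega> * \<eta> j \<omega>)) = (\<lambda>\<omega>. (W i \<omega> * W j \<omega>) * (\<eta> i \<omega> * \<eta> j \<omega>))"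
    by (simp add: fun_eq_iff mult_ac)
  show "integrable M (\<lambda>\<omega>. (W i \<omega> * \<eta> i \<omega>) * (W j \<omega> * \<eta> j \<omega>))"
    unfolding eq by (rule indep_var_integrable[OF ints])
  assume ne: "i \<noteq> j"
  show "expectation (\<lambda>\<omega>. (W i \<omega> * \<eta> i \<omega>) * (W j \<omega> * \<eta> j \<omega>))
      = expectation (\<lambda>\<omega>. W i \<omega> * \<eta> i \<omega>) * expectation (\<lambda>\<omega>. W j \<omega> * \<eta> j \<omega>)"
    unfolding eq indep_var_lebesgue_integral[OF ints]
      indep_vars_expectation_mult[OF indep_W i j ne integrable_W[OF i m(1)] integrable_W[OF j m(2)]]
      indep_vars_expectation_mult[OF indep_\<eta> i j ne integrable_\<eta>[OF i] integrable_\<eta>[OF j]]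
      expectation_W[OF i m(1)] expectation_W[OF j m(2)] expectation_\<eta>[OF i] expectation_\<eta>[OF j]
      expectation_summand[OF i m(1)] expectation_summand[OF j m(2)]
    by (simp add: power2_eq_square algebra_simps)
qed

text \<open>The bound for a fixed committee size; \<open>16\<close> is the \<open>4\<close> from the
  variance bound \<open>n / 4\<close> times the square of the factor \<open>2\<close> in the
  mean.\<close>

lemma error_bound:
  assumes m: "\<And>i. i \<in> {1..n} \<Longrightarrow> m i > 0" and pos: "(\<Sum>i=1..n. (p i - 1 / 2)\<^sup>2) > 0"
  shows "prob {\<omega> \<in> space M. lc_rule n m (\<lambda>i. X i \<omega>) (\<lambda>i. K i \<omega>) \<noteq> Y \<omega>}
    \<le> real n / (16 * (\<Sum>i=1..n. (p i - 1 / 2)\<^sup>2)\<^sup>2)"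
proof -
  define s where "s = (\<Sum>i=1..n. (p i - 1 / 2)\<^sup>2)"
  define Z where "Z i \<omega> = W i \<omega> * \<eta> i \<omega>" for i \<omega>
  define S where "S \<omega> = (\<Sum>i=1..n. Z i \<omega>)" for \<omega>
  have Z_meas: "random_variable borel (Z i)" if "i \<in> {1..n}" for i
    using measurable_W[OF that] measurable_\<eta>[OF that] unfolding Z_def by measurable
  have S_meas [measurable]: "random_variable borel S"
    unfolding S_def using Z_meas by (intro borel_measurable_sum) auto
  have Z_bound: "AE \<omega> in M. \<bar>Z i \<omega>\<bar> \<le> 1 / 2" if "i \<in> {1..n}" for i
    using AE_abs_W[OF that m[OF that]] by (simp add: Z_def abs_mult abs_\<eta>)
  have Z_int: "integrable M (Z i)" if "i \<in> {1..n}" for i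
    using Z_bound Z_meas that by (intro integrable_const_bound[where B = "1 / 2"]) auto
  have Z_prod: "integrable M (\<lambda>\<omega>. Z i \<omega> * Z j \<omega>)" if "i \<in> {1..n}" "j \<in> {1..n}" for i j
    unfolding Z_def using summands_product(1) that m by blast
  have ES: "expectation S = 2 * s"
    unfolding S_def s_def sum_distrib_left using Z_int m
    by (simp add: Bochner_Integration.integral_sum) (simp add: Z_def expectation_summand)
  have "variance S = (\<Sum>i=1..n. variance (Z i))"
    unfolding S_def using Z_int Z_prod summands_product(2) m
    by (intro variance_sum_uncorrelated) (auto simp: Z_def[abs_def])
  also have "\<dots> \<le> (\<Sum>i=1..n. (1 / 2)\<^sup>2)"
    by (intro sum_mono variance_le_of_bounded Z_meas Z_bound)
  finally have VS: "variance S \<le> real n / 4"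
    by (simp add: power2_eq_square)
  have "integrable M (\<lambda>\<omega>. (S \<omega>)\<^sup>2)"
    unfolding S_def power2_eq_square sum_product
    using Z_prod by (intro Bochner_Integration.integrable_sum)
  \<comment> \<open>The threshold is the mean of \<open>S\<close> itself, so that
    \<open>S \<omega> \<le> 0\<close> forces a deviation of at least this size.\<close>
  note Chebyshev = Chebyshev_inequality[OF S_meas this, of "2 * s"]
  have "prob {\<omega> \<in> space M. lc_rule n m (\<lambda>i. X i \<omega>) (\<lambda>i. K i \<omega>) \<noteq> Y \<omega>}
      = prob {\<omega> \<in> space M. S \<omega> \<le> 0}"
    by (intro arg_cong[where f = prob] Collect_cong conj_cong refl)
       (simp add: lc_rule_error_iff S_def Z_def W_def \<eta>_def)
  also have "\<dots> \<le> prob {\<omega> \<in> space M. \<bar>S \<omega> - expectation S\<bar> \<ge> 2 * s}"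
    by (intro finite_measure_mono) (auto simp: ES)
  also have "\<dots> \<le> variance S / (2 * s)\<^sup>2"
    using Chebyshev pos by (simp add: s_def)
  also have "\<dots> \<le> (real n / 4) / (2 * s)\<^sup>2"
    using VS by (intro divide_right_mono) auto
  finally show ?thesis
    by (simp add: s_def power_mult_distrib)
qed

end

section \<open>Passage to the limit\<close>

theorem theorem5:
  fixes p :: "nat \<Rightarrow> real"
    and m :: "nat \<Rightarrow> nat"
    and M :: "nat \<Rightarrow> 'a measure"
    and Y :: "nat \<Rightarrow> 'a \<Rightarrow> real"
    and X :: "nat \<Rightarrow> nat \<Rightarrow> 'a \<Rightarrow> real"
    and K :: "nat \<Rightarrow> nat \<Rightarrow> 'a \<Rightarrow> nat"
  assumes "\<And>i. i \<ge> 1 \<Longrightarrow> 0 < p i \<and> p i < 1"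
    and "\<And>i. i \<ge> 1 \<Longrightarrow> m i > 0"
    and "\<And>n. n \<ge> 1 \<Longrightarrow> committee (M n) n p m (Y n) (X n) (K n)"
    and "filterlim (\<lambda>n. 1 / sqrt (real n) * (\<Sum>i=1..n. (p i - 1 / 2)\<^sup>2)) at_top sequentially"
  shows "(\<lambda>n. measure (M n) {\<omega> \<in> space (M n).
            lc_rule n m (\<lambda>i. X n i \<omega>) (\<lambda>i. K n i \<omega>) \<noteq> Y n \<omega>}) \<longlonglongrightarrow> 0"
proof -
  define s where "s n = (\<Sum>i=1..n. (p i - 1 / 2)\<^sup>2)" for n
  define T where "T n = 1 / sqrt (real n) * s n" for n
  have T: "filterlim T at_top sequentially"
    using assms(4) unfolding T_def s_def .
  have "filterlim (\<lambda>n. 16 * (T n)\<^sup>2) at_top sequentially"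
    by (intro filterlim_tendsto_pos_mult_at_top[OF tendsto_const] filterlim_pow_at_top T) auto
  then have lim: "(\<lambda>n. 1 / (16 * (T n)\<^sup>2)) \<longlonglongrightarrow> 0"
    using tendsto_divide_0[OF tendsto_const filterlim_at_top_imp_at_infinity] by blast
  have "\<forall>\<^sub>F n in sequentially. T n > 0"
    using T by (simp add: filterlim_at_top_dense)
  \<comment> \<open>The bound is applied in each space \<open>M n\<close> separately. It needs
    \<open>n \<ge> 1\<close> for the committee to be given, and \<open>T n > 0\<close> for its
    denominator to be positive.\<close>
  with eventually_ge_at_top[of 1] have "\<forall>\<^sub>F n in sequentially. measure (M n) {\<omega> \<in> space (M n).
      lc_rule n m (\<lambda>i. X n i \<omega>) (\<lambda>i. K n i \<omega>) \<noteq> Y n \<omega>} \<le> 1 / (16 * (T n)\<^sup>2)"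
  proof eventually_elim
    case (elim n)
    then have pos: "s n > 0"
      by (simp add: T_def zero_less_divide_iff)
    have "measure (M n) {\<omega> \<in> space (M n).
        lc_rule n m (\<lambda>i. X n i \<omega>) (\<lambda>i. K n i \<omega>) \<noteq> Y n \<omega>} \<le> real n / (16 * (s n)\<^sup>2)"
      using committee.error_bound[OF assms(3)[OF elim(1)]] assms(2) pos by (simp add: s_def)
    \<comment> \<open>Squaring \<open>T n\<close> turns the factor \<open>1 / sqrt n\<close> into
      \<open>1 / n\<close>, which absorbs the numerator.\<close>
    also have "\<dots> = 1 / (16 * (T n)\<^sup>2)"
      by (simp add: T_def power_divide)
    finally show ?case .
  qed
  \<comment> \<open>The lower bound of the sandwich is the constant \<open>0\<close>, by
    nonnegativity of measures.\<close>
  from tendsto_sandwich[OF _ this tendsto_const lim] show ?thesis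
    by simp
qed

end
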